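(* For every $\epsilon\in(0,1]$, the algorithm SSF-I on $m$ identical machines each of speed $1+\epsilon$ is $O(\frac{1}{\epsilon})$-competitive for minimizing the maximum delay factor in online unicast scheduling, relative to an optimal offline schedule on $m$ identical machines of speed $1$.
   Context: Unicast scheduling: requests $J_i$ arrive online; each has arrival time $a_i$, deadline $d_i$ and processing time $\ell_i$, revealed at time $a_i$, with slack $S_i = d_i - a_i \ge \ell_i$. Preemption is allowed. The delay factor of a schedule on $\sigma$ is $\max\{1,\max_{J_i}(f_i-a_i)/(d_i-a_i)\}$ where $f_i$ is the completion time of $J_i$. A request is in class $k$ (an integer) if $S_i\in[2^k,2^{k+1})$. For a machine $x$ and time $t$, $U^x_{=k}(t)$ denotes the total processing time of class-$k$ requests assigned to machine $x$ by time $t$. SSF-I: when a request of class $k$ arrives at time $t$, it is immediately and permanently assigned to a machine $x$ with $U^x_{=k}(t)=\min_y U^y_{=k}(t)$; each machine independently runs shortest-slack-first (at every time, process the unfinished request assigned to it with minimum slack). An algorithm is $s$-speed $r$-competitive if, when its machines have speed $s$, its delay factor on every sequence is at most $r$ times the optimal offline delay factor achievable with the same number of speed-$1$ machines. *)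

theory Defs
  imports "HOL-Analysis.Analysis"
begin

record request =
  arrival :: real
  deadline :: real
  processing :: real

definition slack :: "request \<Rightarrow> real" where
  "slack r = deadline r - arrival r"

definition in_class :: "int \<Rightarrow> request \<Rightarrow> bool" where
  "in_class k r \<longleftrightarrow> 2 powi k \<le> slack r \<and> slack r < 2 powi (k + 1)"

text \<open>Requests are listed in the order in which they are presented to the online algorithm;
  requests may share an arrival time.\<close>

definition request_sequence :: "request list \<Rightarrow> bool" where
  "request_sequence \<sigma> \<longleftrightarrow> sorted (map arrival \<sigma>) \<and>
     (\<forall>r \<in> set \<sigma>. 0 < processing r \<and> processing r \<le> slack r)"

text \<open>A schedule tells for each machine and time the index of the request being processed, if any.
  Only machines \<open>0, \<dots>, m - 1\<close> are relevant.\<close>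

type_synonym schedule = "nat \<Rightarrow> real \<Rightarrow> nat option"

text \<open>Preemption and migration are allowed, but a request never runs on two machines at once.\<close>

definition feasible :: "nat \<Rightarrow> request list \<Rightarrow> schedule \<Rightarrow> bool" where
  "feasible m \<sigma> S \<longleftrightarrow>
     (\<forall>x<m. \<forall>i. {t. S x t = Some i} \<in> sets lebesgue) \<and>
     (\<forall>x<m. \<forall>t i. S x t = Some i \<longrightarrow> i < length \<sigma> \<and> arrival (\<sigma> ! i) \<le> t) \<and>
     (\<forall>x<m. \<forall>y<m. \<forall>t i. S x t = Some i \<and> S y t = Some i \<longrightarrow> x = y)"

definition work :: "real \<Rightarrow> nat \<Rightarrow> schedule \<Rightarrow> nat \<Rightarrow> real \<Rightarrow> real" where
  "work s m S i t = (\<Sum>x<m. s * measure lebesgue {u. u < t \<and> S x u = Some i})"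

text \<open>The completion time is \<open>\<infinity>\<close> for a request that is never completed.\<close>

definition completion :: "real \<Rightarrow> nat \<Rightarrow> request list \<Rightarrow> schedule \<Rightarrow> nat \<Rightarrow> ereal" where
  "completion s m \<sigma> S i =
     Inf {ereal t | t. arrival (\<sigma> ! i) \<le> t \<and> processing (\<sigma> ! i) \<le> work s m S i t}"

definition delay_factor :: "real \<Rightarrow> nat \<Rightarrow> request list \<Rightarrow> schedule \<Rightarrow> ereal" where
  "delay_factor s m \<sigma> S =
     Max (insert 1 ((\<lambda>i. (completion s m \<sigma> S i - ereal (arrival (\<sigma> ! i))) / ereal (slack (\<sigma> ! i)))
                      ` {..<length \<sigma>}))"

definition opt :: "nat \<Rightarrow> request list \<Rightarrow> ereal" where
  "opt m \<sigma> = (INF S \<in> {S. feasible m \<sigma> S}. delay_factor 1 m \<sigma> S)"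

text \<open>The load \<open>class_load \<sigma> asg x k i\<close> is \<open>U\<^sup>x\<^bsub>=k\<^esub>\<close> at the moment request \<open>i\<close> is presented:
  the requests assigned by then are those preceding it in the sequence, including
  preceding ones with the same arrival time.\<close>

definition class_load :: "request list \<Rightarrow> (nat \<Rightarrow> nat) \<Rightarrow> nat \<Rightarrow> int \<Rightarrow> nat \<Rightarrow> real" where
  "class_load \<sigma> asg x k i =
     (\<Sum>j | j < i \<and> in_class k (\<sigma> ! j) \<and> asg j = x. processing (\<sigma> ! j))"

definition immediate_dispatch :: "nat \<Rightarrow> request list \<Rightarrow> (nat \<Rightarrow> nat) \<Rightarrow> bool" where
  "immediate_dispatch m \<sigma> asg \<longleftrightarrow>
     (\<forall>i<length \<sigma>. \<forall>k. in_class k (\<sigma> ! i) \<longrightarrow>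
        is_arg_min (\<lambda>x. class_load \<sigma> asg x k i) (\<lambda>x. x < m) (asg i))"

definition pending ::
  "real \<Rightarrow> nat \<Rightarrow> request list \<Rightarrow> (nat \<Rightarrow> nat) \<Rightarrow> schedule \<Rightarrow> nat \<Rightarrow> real \<Rightarrow> nat set" where
  "pending s m \<sigma> asg S x t =
     {i. i < length \<sigma> \<and> asg i = x \<and> arrival (\<sigma> ! i) \<le> t \<and> work s m S i t < processing (\<sigma> ! i)}"

definition shortest_slack_first ::
  "real \<Rightarrow> nat \<Rightarrow> request list \<Rightarrow> (nat \<Rightarrow> nat) \<Rightarrow> schedule \<Rightarrow> bool" where
  "shortest_slack_first s m \<sigma> asg S \<longleftrightarrow>
     (\<forall>x<m. \<forall>t. case S x t of
        None \<Rightarrow> pending s m \<sigma> asg S x t = {}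
      | Some i \<Rightarrow> is_arg_min (\<lambda>j. slack (\<sigma> ! j)) (\<lambda>j. j \<in> pending s m \<sigma> asg S x t) i)"

text \<open>\<open>SSF_I s m \<sigma> S\<close> holds if \<open>S\<close> is a possible outcome of SSF-I on \<open>\<sigma>\<close> with \<open>m\<close> machines of
  speed \<open>s\<close>; ties, both in the dispatching and among equal slacks, are broken arbitrarily.\<close>

definition SSF_I :: "real \<Rightarrow> nat \<Rightarrow> request list \<Rightarrow> schedule \<Rightarrow> bool" where
  "SSF_I s m \<sigma> S \<longleftrightarrow> feasible m \<sigma> S \<and>
     (\<exists>asg. immediate_dispatch m \<sigma> asg \<and> shortest_slack_first s m \<sigma> asg S)"

definition competitive ::
  "(real \<Rightarrow> nat \<Rightarrow> request list \<Rightarrow> schedule \<Rightarrow> bool) \<Rightarrow> nat \<Rightarrow> real \<Rightarrow> real \<Rightarrow> bool" where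
  "competitive alg m s r \<longleftrightarrow>
     (\<forall>\<sigma> S. request_sequence \<sigma> \<and> alg s m \<sigma> S \<longrightarrow> delay_factor s m \<sigma> S \<le> ereal r * opt m \<sigma>)"

end

theory Submission
  imports Defs
begin

text \<open>Fix a request \<open>i\<close> of class \<open>k\<close> that is unfinished at time \<open>T\<close> on its machine \<open>x\<close>, and let
  \<open>b\<close> be the start of the maximal period up to \<open>T\<close> in which \<open>x\<close> only processes requests of slack
  at most that of \<open>i\<close>. All work done in \<open>[b, T)\<close> belongs to requests of class at most \<open>k\<close> that
  arrived on \<open>x\<close> after \<open>b\<close>. Greedy dispatching keeps the class-\<open>c\<close> loads of any two machines within
  \<open>2\<^bsup>c + 1\<^esup>\<close> of each other, so every machine receives in this period that much volume of class
  at most \<open>k\<close>, up to \<open>2\<^bsup>k + 3\<^esup>\<close>. An optimal schedule of delay factor \<open>\<alpha>\<close> finishes this volume by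
  \<open>T + \<alpha> 2\<^bsup>k + 1\<^esup>\<close> at speed 1, whence \<open>\<epsilon> (T - b) \<le> \<alpha> 2\<^bsup>k + 1\<^esup> + 2\<^bsup>k + 3\<^esup>\<close>.\<close>

subsection \<open>Slack classes\<close>

text \<open>Distinct powers of two sum to at most twice the largest. This makes the imbalance
  accumulated over all classes up to \<open>k\<close> independent of how many classes occur.\<close>

lemma sum_powi2_le:
  fixes K :: "int set"
  assumes "finite K" "\<And>c. c \<in> K \<Longrightarrow> c \<le> k"
  shows "(\<Sum>c\<in>K. 2 powi c) \<le> (2::real) powi (k + 1)"
  using assms
proof (induction K arbitrary: k rule: finite_linorder_max_induct)
  case empty
  then show ?case by simp
next
  case (insert b A)
  have "(\<Sum>c\<in>A. 2 powi c) \<le> (2::real) powi (b - 1 + 1)"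
    using insert.hyps by (intro insert.IH) force
  then have "(\<Sum>c\<in>insert b A. 2 powi c) \<le> (2::real) powi (b + 1)"
    using insert.hyps by (subst sum.insert) (auto simp: power_int_add)
  also have "\<dots> \<le> 2 powi (k + 1)"
    using insert.prems by (intro power_int_increasing) auto
  finally show ?case .
qed

text \<open>For positive slack this is the unique class; a function, unlike \<open>in_class\<close>,
  lets classes be compared by order.\<close>

definition class_of :: "request \<Rightarrow> int" where
  "class_of r = \<lfloor>log 2 (slack r)\<rfloor>"

lemma in_class_iff:
  assumes "0 < slack r"
  shows "in_class k r \<longleftrightarrow> class_of r = k"
proof -
  have "(2::real) powi j = 2 powr real_of_int j" for j :: int
    by (simp add: powr_real_of_int')
  then show ?thesis
    using assms unfolding in_class_def class_of_def floor_eq_iff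
    by (simp add: le_log_iff log_less_iff)
qed

lemma class_of_mono:
  assumes "0 < slack r" "slack r \<le> slack r'"
  shows "class_of r \<le> class_of r'"
  using assms unfolding class_of_def by (intro floor_mono) auto

lemma class_of_bounds:
  assumes "0 < slack r"
  shows "2 powi class_of r \<le> slack r" "slack r < 2 powi (class_of r + 1)"
  using in_class_iff[OF assms, of "class_of r"] unfolding in_class_def by auto

lemma request_sequenceD:
  assumes "request_sequence \<sigma>" "i < length \<sigma>"
  shows "0 < processing (\<sigma> ! i)" "processing (\<sigma> ! i) \<le> slack (\<sigma> ! i)" "0 < slack (\<sigma> ! i)"
  using assms unfolding request_sequence_def by (force dest: nth_mem)+

subsection \<open>Balance of immediate dispatching\<close>

lemma immediate_dispatch_less:
  assumes "request_sequence \<sigma>" "immediate_dispatch m \<sigma> asg" "i < length \<sigma>"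
  shows "asg i < m"
  using assms(2,3) in_class_iff[OF request_sequenceD(3)[OF assms(1,3)]]
  unfolding immediate_dispatch_def is_arg_min_def by auto

lemma class_load_Suc:
  "class_load \<sigma> asg x k (Suc n) = class_load \<sigma> asg x k n
     + (if in_class k (\<sigma> ! n) \<and> asg n = x then processing (\<sigma> ! n) else 0)"
proof -
  have "{j. j < Suc n \<and> in_class k (\<sigma> ! j) \<and> asg j = x} =
      (if in_class k (\<sigma> ! n) \<and> asg n = x
       then insert n {j. j < n \<and> in_class k (\<sigma> ! j) \<and> asg j = x}
       else {j. j < n \<and> in_class k (\<sigma> ! j) \<and> asg j = x})"
    by (auto simp: less_Suc_eq)
  then show ?thesis
    unfolding class_load_def by simp
qed

text \<open>A machine receives a class-\<open>k\<close> request only while its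
  class-\<open>k\<close> load is minimal, so it gets ahead of another machine by at most one
  processing time, which is bounded by the slack.\<close>

lemma class_load_balanced:
  assumes "request_sequence \<sigma>" "immediate_dispatch m \<sigma> asg" "n \<le> length \<sigma>" "x < m" "y < m"
  shows "class_load \<sigma> asg x k n \<le> class_load \<sigma> asg y k n + 2 powi (k + 1)"
  using assms(3-5)
proof (induction n arbitrary: x y)
  case 0
  then show ?case by (simp add: class_load_def)
next
  case (Suc n)
  have n: "n < length \<sigma>" using Suc.prems by simp
  note p = request_sequenceD[OF assms(1) n]
  show ?case
  proof (cases "in_class k (\<sigma> ! n) \<and> asg n = x")
    case True
    then have "class_load \<sigma> asg x k n \<le> class_load \<sigma> asg y k n"
      using assms(2) n Suc.prems unfolding immediate_dispatch_def is_arg_min_linorder by auto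
    moreover have "processing (\<sigma> ! n) \<le> 2 powi (k + 1)"
      using True p unfolding in_class_def by auto
    ultimately show ?thesis
      using p by (auto simp: class_load_Suc)
  next
    case False
    then show ?thesis
      using Suc.IH[of x y] Suc.prems p by (auto simp: class_load_Suc)
  qed
qed

text \<open>The window is a range of positions, not of times, because \<open>class_load\<close>
  counts the requests preceding a position.\<close>

definition arrived_volume ::
  "request list \<Rightarrow> (nat \<Rightarrow> nat) \<Rightarrow> nat \<Rightarrow> int \<Rightarrow> nat \<Rightarrow> nat \<Rightarrow> real" where
  "arrived_volume \<sigma> asg x k lo hi =
     (\<Sum>j | lo \<le> j \<and> j < hi \<and> class_of (\<sigma> ! j) \<le> k \<and> asg j = x. processing (\<sigma> ! j))"

text \<open>Infinitely many integers lie below \<open>k\<close>, so the sum over classes is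
  restricted to those that occur in \<open>\<sigma>\<close>.\<close>

lemma arrived_volume_eq:
  fixes k :: int
  assumes "request_sequence \<sigma>" "lo \<le> hi" "hi \<le> length \<sigma>"
  defines "K \<equiv> {c \<in> (\<lambda>j. class_of (\<sigma> ! j)) ` {..<length \<sigma>}. c \<le> k}"
  shows "arrived_volume \<sigma> asg x k lo hi =
    (\<Sum>c\<in>K. class_load \<sigma> asg x c hi - class_load \<sigma> asg x c lo)"
proof -
  have K: "finite K" unfolding K_def by simp
  have diff: "class_load \<sigma> asg x c hi - class_load \<sigma> asg x c lo =
      (\<Sum>j | lo \<le> j \<and> j < hi \<and> class_of (\<sigma> ! j) = c \<and> asg j = x. processing (\<sigma> ! j))" for c
  proof -
    let ?A = "{j. lo \<le> j \<and> j < hi \<and> class_of (\<sigma> ! j) = c \<and> asg j = x}"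
    let ?B = "{j. j < lo \<and> in_class c (\<sigma> ! j) \<and> asg j = x}"
    have in_class: "in_class c (\<sigma> ! j) \<longleftrightarrow> class_of (\<sigma> ! j) = c" if "j < hi" for j
      using in_class_iff request_sequenceD(3)[OF assms(1)] that assms(3) by simp
    have "{j. j < hi \<and> in_class c (\<sigma> ! j) \<and> asg j = x} = ?A \<union> ?B"
      using assms(2) in_class by (auto simp: not_le)
    moreover have "sum f (?A \<union> ?B) = sum f ?A + sum f ?B" for f :: "nat \<Rightarrow> real"
      by (rule sum.union_disjoint) auto
    ultimately show ?thesis unfolding class_load_def by simp
  qed
  have "(\<Sum>c\<in>K. class_load \<sigma> asg x c hi - class_load \<sigma> asg x c lo) =
     sum (\<lambda>j. processing (\<sigma> ! j))
       (\<Union>c\<in>K. {j. lo \<le> j \<and> j < hi \<and> class_of (\<sigma> ! j) = c \<and> asg j = x})"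
    unfolding diff by (rule sum.UNION_disjoint[symmetric]) (auto simp: K)
  also have "(\<Union>c\<in>K. {j. lo \<le> j \<and> j < hi \<and> class_of (\<sigma> ! j) = c \<and> asg j = x}) =
      {j. lo \<le> j \<and> j < hi \<and> class_of (\<sigma> ! j) \<le> k \<and> asg j = x}"
    using assms(3) unfolding K_def by auto
  finally show ?thesis unfolding arrived_volume_def by simp
qed

text \<open>Volume in a window is a difference of two loads, so each class \<open>c\<close>
  contributes the imbalance \<open>2 powi (c + 1)\<close> at both ends, that is
  \<open>4 * 2 powi c\<close>. Summing geometrically gives
  \<open>4 * 2 powi (k + 1)\<close>.\<close>

lemma arrived_volume_balanced:
  assumes "request_sequence \<sigma>" "immediate_dispatch m \<sigma> asg" "lo \<le> hi" "hi \<le> length \<sigma>"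
    and "x < m" "y < m"
  shows "arrived_volume \<sigma> asg x k lo hi \<le> arrived_volume \<sigma> asg y k lo hi + 2 powi (k + 3)"
proof -
  define K where "K = {c \<in> (\<lambda>j. class_of (\<sigma> ! j)) ` {..<length \<sigma>}. c \<le> k}"
  have "arrived_volume \<sigma> asg x k lo hi \<le>
      (\<Sum>c\<in>K. class_load \<sigma> asg y c hi - class_load \<sigma> asg y c lo + 4 * 2 powi c)"
    unfolding arrived_volume_eq[OF assms(1,3,4)] K_def[symmetric]
  proof (rule sum_mono)
    fix c
    show "class_load \<sigma> asg x c hi - class_load \<sigma> asg x c lo \<le>
        class_load \<sigma> asg y c hi - class_load \<sigma> asg y c lo + 4 * 2 powi c"
      using class_load_balanced[OF assms(1,2,4,5,6), of c]
        class_load_balanced[OF assms(1,2) _ assms(6,5), of lo c] assms(3,4)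
      by (simp add: power_int_add)
  qed
  also have "\<dots> = arrived_volume \<sigma> asg y k lo hi + 4 * (\<Sum>c\<in>K. 2 powi c)"
    unfolding arrived_volume_eq[OF assms(1,3,4)] K_def[symmetric]
    by (simp add: sum.distrib sum_distrib_left)
  also have "(\<Sum>c\<in>K. 2 powi c) \<le> (2::real) powi (k + 1)"
    by (rule sum_powi2_le) (auto simp: K_def)
  finally show ?thesis by (simp add: power_int_add)
qed

text \<open>Balance against every machine bounds one machine by the average. Only the total volume
  can be compared with an optimal schedule, which may distribute requests differently and migrate
  them.\<close>

lemma arrived_volume_le_average:
  assumes "request_sequence \<sigma>" "immediate_dispatch m \<sigma> asg" "lo \<le> hi" "hi \<le> length \<sigma>" "x < m"
  shows "real m * arrived_volume \<sigma> asg x k lo hi \<le>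
    (\<Sum>j | lo \<le> j \<and> j < hi \<and> class_of (\<sigma> ! j) \<le> k. processing (\<sigma> ! j)) + real m * 2 powi (k + 3)"
proof -
  have "real m * arrived_volume \<sigma> asg x k lo hi \<le>
      (\<Sum>y<m. arrived_volume \<sigma> asg y k lo hi + 2 powi (k + 3))"
    using sum_mono[of "{..<m}" "\<lambda>_. arrived_volume \<sigma> asg x k lo hi"]
      arrived_volume_balanced[OF assms] by simp
  also have "\<dots> = (\<Sum>y<m. arrived_volume \<sigma> asg y k lo hi) + real m * 2 powi (k + 3)"
    by (simp add: sum.distrib)
  also have "(\<Sum>y<m. arrived_volume \<sigma> asg y k lo hi) =
      sum (\<lambda>j. processing (\<sigma> ! j))
        (\<Union>y<m. {j. lo \<le> j \<and> j < hi \<and> class_of (\<sigma> ! j) \<le> k \<and> asg j = y})"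
    unfolding arrived_volume_def by (rule sum.UNION_disjoint[symmetric]) auto
  also have "(\<Union>y<m. {j. lo \<le> j \<and> j < hi \<and> class_of (\<sigma> ! j) \<le> k \<and> asg j = y}) =
      {j. lo \<le> j \<and> j < hi \<and> class_of (\<sigma> ! j) \<le> k}"
    using immediate_dispatch_less[OF assms(1,2)] assms(4) by auto
  finally show ?thesis .
qed

subsection \<open>Work in feasible schedules\<close>

text \<open>No request runs before it arrives, so cutting at \<open>t\<close> leaves a bounded set
  and its measure is finite.\<close>

lemma feasible_lmeasurable:
  assumes "feasible m \<sigma> S" "x < m"
  shows "{u. u < t \<and> S x u = Some i} \<in> lmeasurable"
    and "{u. b \<le> u \<and> u < t \<and> S x u = Some i} \<in> lmeasurable"
proof -
  have Ico: "{c..<d} \<in> lmeasurable" for c d :: real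
    by (intro bounded_set_imp_lmeasurable) (auto intro: bounded_subset[of "{c..d}"])
  have S: "{u. S x u = Some i} \<in> sets lebesgue"
    using assms unfolding feasible_def by blast
  have "{u. u < t \<and> S x u = Some i} = {arrival (\<sigma> ! i)..<t} \<inter> {u. S x u = Some i}"
    using assms unfolding feasible_def by auto
  moreover have "{arrival (\<sigma> ! i)..<t} \<inter> {u. S x u = Some i} \<in> lmeasurable"
    using Ico S by (rule fmeasurable_Int_fmeasurable)
  ultimately show *: "{u. u < t \<and> S x u = Some i} \<in> lmeasurable"
    by (simp only:)
  have "{u. b \<le> u \<and> u < t \<and> S x u = Some i} = {u. u < t \<and> S x u = Some i} \<inter> {b..<t}"
    by auto
  then show "{u. b \<le> u \<and> u < t \<and> S x u = Some i} \<in> lmeasurable"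
    using fmeasurable.Int[OF * Ico] by (simp only:)
qed

lemma work_mono:
  assumes "feasible m \<sigma> S" "0 \<le> s" "t \<le> t'"
  shows "work s m S i t \<le> work s m S i t'"
  unfolding work_def using assms
  by (intro sum_mono mult_left_mono measure_mono_fmeasurable)
    (auto intro: feasible_lmeasurable dest: fmeasurableD[OF feasible_lmeasurable(1)])

text \<open>A machine runs one request at a time, so the sets are disjoint parts of one
  interval.\<close>

lemma sum_measure_le_interval:
  assumes "feasible m \<sigma> S" "x < m" "finite J" "b \<le> t"
  shows "(\<Sum>j\<in>J. measure lebesgue {u. b \<le> u \<and> u < t \<and> S x u = Some j}) \<le> t - b"
proof -
  have "(\<Sum>j\<in>J. measure lebesgue {u. b \<le> u \<and> u < t \<and> S x u = Some j}) =
      measure lebesgue (\<Union>j\<in>J. {u. b \<le> u \<and> u < t \<and> S x u = Some j})"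
    using assms feasible_lmeasurable(2)[OF assms(1,2)]
    by (intro measure_finite_Union[symmetric])
      (auto simp: disjoint_family_on_def fmeasurableD fmeasurableD2 simp del: emeasure_completion)
  also have "\<dots> \<le> measure lebesgue {b..t}"
    using assms feasible_lmeasurable(2)[OF assms(1,2)]
    by (intro measure_mono_fmeasurable sets.finite_UN) (auto simp: fmeasurableD)
  finally show ?thesis using assms by simp
qed

text \<open>Capacity bound for speed 1: requests arriving from \<open>b\<close> on can be processed
  only inside the window from \<open>b\<close> to \<open>t\<close>.\<close>

lemma sum_processing_le:
  assumes "feasible m \<sigma> S" "finite J" "b \<le> t"
    and "\<And>j. j \<in> J \<Longrightarrow> b \<le> arrival (\<sigma> ! j)"
    and "\<And>j. j \<in> J \<Longrightarrow> processing (\<sigma> ! j) \<le> work 1 m S j t"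
  shows "(\<Sum>j\<in>J. processing (\<sigma> ! j)) \<le> real m * (t - b)"
proof -
  have "(\<Sum>j\<in>J. processing (\<sigma> ! j)) \<le> (\<Sum>j\<in>J. work 1 m S j t)"
    using assms by (intro sum_mono)
  also have "\<dots> = (\<Sum>j\<in>J. \<Sum>x<m. measure lebesgue {u. b \<le> u \<and> u < t \<and> S x u = Some j})"
  proof (intro sum.cong refl)
    fix j assume "j \<in> J"
    then have "{u. u < t \<and> S x u = Some j} = {u. b \<le> u \<and> u < t \<and> S x u = Some j}" if "x < m" for x
      using assms(1) assms(4)[of j] that unfolding feasible_def by force
    then show "work 1 m S j t = (\<Sum>x<m. measure lebesgue {u. b \<le> u \<and> u < t \<and> S x u = Some j})"
      unfolding work_def by simp
  qed
  also have "\<dots> = (\<Sum>x<m. \<Sum>j\<in>J. measure lebesgue {u. b \<le> u \<and> u < t \<and> S x u = Some j})"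
    by (rule sum.swap)
  also have "\<dots> \<le> (\<Sum>x<m. t - b)"
    using assms by (intro sum_mono sum_measure_le_interval) auto
  finally show ?thesis by simp
qed

text \<open>\<open>completion\<close> is an infimum, so the strict inequality for \<open>t\<close>
  yields an actual earlier time at which the work is done, and work is monotone.\<close>

lemma work_ge_processing_if_delay_le:
  assumes "delay_factor s m \<sigma> S \<le> ereal \<alpha>" "feasible m \<sigma> S" "0 \<le> s" "i < length \<sigma>"
    and "0 < slack (\<sigma> ! i)" "arrival (\<sigma> ! i) + \<alpha> * slack (\<sigma> ! i) < t"
  shows "processing (\<sigma> ! i) \<le> work s m S i t"
proof -
  let ?c = "completion s m \<sigma> S i" and ?a = "arrival (\<sigma> ! i)" and ?s = "slack (\<sigma> ! i)"
  have "(?c - ereal ?a) / ereal ?s \<le> ereal \<alpha>"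
    using assms(1,4) unfolding delay_factor_def by (subst (asm) Max_le_iff) auto
  moreover have "ereal ?a \<le> ?c"
    unfolding completion_def by (auto intro: Inf_greatest)
  ultimately have "?c \<le> ereal (?a + \<alpha> * ?s)"
    using assms(5) by (cases ?c) (auto simp: field_simps)
  also have "\<dots> < ereal t" using assms(6) by simp
  finally obtain t' where "t' < t" "processing (\<sigma> ! i) \<le> work s m S i t'"
    unfolding completion_def Inf_less_iff by auto
  then show ?thesis
    using work_mono[OF assms(2,3), of t' t i] by linarith
qed

subsection \<open>Shortest slack first\<close>

locale ssf_run =
  fixes s :: real and m :: nat and \<sigma> :: "request list" and asg :: "nat \<Rightarrow> nat" and S :: schedule
  assumes requests: "request_sequence \<sigma>"
    and feasible: "feasible m \<sigma> S"
    and dispatch: "immediate_dispatch m \<sigma> asg"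
    and ssf: "shortest_slack_first s m \<sigma> asg S"
    and speed: "0 < s"
begin

lemma asg_less: "i < length \<sigma> \<Longrightarrow> asg i < m"
  using immediate_dispatch_less[OF requests dispatch] .

lemma running_pending:
  assumes "x < m" "S x t = Some j"
  shows "j \<in> pending s m \<sigma> asg S x t"
proof -
  have "case S x t of None \<Rightarrow> pending s m \<sigma> asg S x t = {}
      | Some i \<Rightarrow> is_arg_min (\<lambda>j. slack (\<sigma> ! j)) (\<lambda>j. j \<in> pending s m \<sigma> asg S x t) i"
    using ssf assms(1) unfolding shortest_slack_first_def by blast
  then show ?thesis using assms(2) by (simp add: is_arg_min_def)
qed

lemma pending_running:
  assumes "x < m" "i \<in> pending s m \<sigma> asg S x t"
  obtains j where "S x t = Some j" "slack (\<sigma> ! j) \<le> slack (\<sigma> ! i)"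
proof -
  have "case S x t of None \<Rightarrow> pending s m \<sigma> asg S x t = {}
      | Some i \<Rightarrow> is_arg_min (\<lambda>j. slack (\<sigma> ! j)) (\<lambda>j. j \<in> pending s m \<sigma> asg S x t) i"
    using ssf assms(1) unfolding shortest_slack_first_def by blast
  then show ?thesis using assms(2) that by (cases "S x t") (auto simp: is_arg_min_linorder)
qed

lemma pending_antimono:
  assumes "i \<in> pending s m \<sigma> asg S x t" "arrival (\<sigma> ! i) \<le> t'" "t' \<le> t"
  shows "i \<in> pending s m \<sigma> asg S x t'"
  using assms work_mono[OF feasible _ assms(3), of s i] speed unfolding pending_def by auto

text \<open>Only pending requests run, and these are assigned to the machine that runs them, so
  there is no migration.\<close>

lemma work_eq:
  assumes "i < length \<sigma>"
  shows "work s m S i t = s * measure lebesgue {u. u < t \<and> S (asg i) u = Some i}"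
proof -
  have "{u. u < t \<and> S x u = Some i} = {}" if "x < m" "x \<noteq> asg i" for x
    using running_pending[OF that(1)] that(2) unfolding pending_def by auto
  then have "work s m S i t =
      (\<Sum>x<m. if x = asg i then s * measure lebesgue {u. u < t \<and> S (asg i) u = Some i} else 0)"
    unfolding work_def by (intro sum.cong) (auto simp del: Collect_empty_eq)
  then show ?thesis using asg_less[OF assms] by simp
qed

text \<open>A request runs only while unfinished, hence is never overprocessed. The time set
  \<open>E\<close> may have no last element, so the bound is shown up to an arbitrary
  \<open>\<delta>\<close>.\<close>

lemma work_le_processing:
  assumes "i < length \<sigma>"
  shows "work s m S i t \<le> processing (\<sigma> ! i)"
proof -
  define E where "E = {u. u < t \<and> S (asg i) u = Some i}"
  have meas: "{u. u < v \<and> S (asg i) u = Some i} \<in> lmeasurable" for v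
    using feasible_lmeasurable(1)[OF feasible asg_less[OF assms]] .
  have "s * measure lebesgue E \<le> processing (\<sigma> ! i) + \<delta>" if "0 < \<delta>" for \<delta>
  proof (cases "E = {}")
    case True
    then show ?thesis using that request_sequenceD(1)[OF requests assms] by simp
  next
    case False
    have bdd: "bdd_above E" unfolding E_def by (auto intro!: bdd_aboveI[of _ t])
    have "Sup E - \<delta> / s < Sup E" using that speed by simp
    \<comment> \<open>At \<open>v\<close> the request is still running, so less than its processing
      time was done before; the rest of \<open>E\<close> has length at most
      \<open>\<delta> / s\<close>, worth \<open>\<delta>\<close> units of work.\<close>
    then obtain v where v: "v \<in> E" "Sup E - \<delta> / s < v"
      using less_cSup_iff[OF False bdd] by blast
    have sub: "E \<subseteq> {u. u < v \<and> S (asg i) u = Some i} \<union> {v..v + \<delta> / s}"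
    proof
      fix u assume "u \<in> E"
      then have "u \<le> Sup E" using bdd by (rule cSup_upper)
      then show "u \<in> {u. u < v \<and> S (asg i) u = Some i} \<union> {v..v + \<delta> / s}"
        using v \<open>u \<in> E\<close> unfolding E_def by auto
    qed
    have "measure lebesgue E \<le>
        measure lebesgue ({u. u < v \<and> S (asg i) u = Some i} \<union> {v..v + \<delta> / s})"
      using sub meas unfolding E_def
      by (intro measure_mono_fmeasurable) (auto intro: fmeasurable.Un fmeasurableD)
    also have "\<dots> \<le> measure lebesgue {u. u < v \<and> S (asg i) u = Some i}
        + measure lebesgue {v..v + \<delta> / s}"
      using meas by (intro measure_Un_le) (auto intro: fmeasurableD)
    finally have "s * measure lebesgue E \<le>
        s * (measure lebesgue {u. u < v \<and> S (asg i) u = Some i} + \<delta> / s)"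
      using that speed by simp
    also have "\<dots> = work s m S i v + \<delta>"
      using speed by (simp add: work_eq[OF assms] algebra_simps)
    also have "work s m S i v < processing (\<sigma> ! i)"
      using v running_pending[OF asg_less[OF assms]] unfolding E_def pending_def by blast
    finally show ?thesis by simp
  qed
  then have "s * measure lebesgue E \<le> processing (\<sigma> ! i)" by (rule field_le_epsilon)
  then show ?thesis unfolding work_eq[OF assms] E_def .
qed

text \<open>By maximality of the busy period no request of small slack is left over from before
  \<open>b\<close>. The speed-\<open>s\<close> work on \<open>x\<close> up to \<open>T\<close> is
  therefore paid for by requests arriving within the window.\<close>

lemma busy_period:
  assumes i: "i \<in> pending s m \<sigma> asg S x T"
  defines "k \<equiv> class_of (\<sigma> ! i)"
  obtains b where "b \<le> arrival (\<sigma> ! i)"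
    "s * (T - b) \<le>
       (\<Sum>j | j < length \<sigma> \<and> b \<le> arrival (\<sigma> ! j) \<and> arrival (\<sigma> ! j) \<le> T
              \<and> class_of (\<sigma> ! j) \<le> k \<and> asg j = x. processing (\<sigma> ! j))"
proof -
  define busy where "busy b \<longleftrightarrow>
    (\<forall>t. b \<le> t \<and> t \<le> T \<longrightarrow> (\<exists>j. S x t = Some j \<and> slack (\<sigma> ! j) \<le> slack (\<sigma> ! i)))" for b
  define A where "A = {arrival (\<sigma> ! j) | j. j < length \<sigma> \<and> busy (arrival (\<sigma> ! j))}"
  define b where "b = Min A"
  have il: "i < length \<sigma>" and xi: "x = asg i" and aT: "arrival (\<sigma> ! i) \<le> T"
    using i unfolding pending_def by auto
  have x: "x < m" using asg_less[OF il] xi by simp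
  have finA: "finite A" unfolding A_def by simp
  have aA: "arrival (\<sigma> ! i) \<in> A"
    using il pending_running[OF x pending_antimono[OF i]] unfolding A_def busy_def by blast
  have bA: "b \<in> A" unfolding b_def using finA aA by (intro Min_in) auto
  then have busy: "busy b" unfolding A_def by auto
  have ba: "b \<le> arrival (\<sigma> ! i)" unfolding b_def using finA aA by simp
  \<comment> \<open>A leftover request of small slack would have kept the machine on small slacks
    since its own arrival, an earlier busy start than \<open>b\<close>.\<close>
  have finished: "j \<notin> pending s m \<sigma> asg S x b"
    if "arrival (\<sigma> ! j) < b" "slack (\<sigma> ! j) \<le> slack (\<sigma> ! i)" for j
  proof
    assume j: "j \<in> pending s m \<sigma> asg S x b"
    have "busy (arrival (\<sigma> ! j))"
      unfolding busy_def
    proof (intro allI impI)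
      fix t assume t: "arrival (\<sigma> ! j) \<le> t \<and> t \<le> T"
      show "\<exists>l. S x t = Some l \<and> slack (\<sigma> ! l) \<le> slack (\<sigma> ! i)"
      proof (cases "b \<le> t")
        case True
        then show ?thesis using busy t unfolding busy_def by blast
      next
        case False
        then have "j \<in> pending s m \<sigma> asg S x t" using pending_antimono[OF j] t by simp
        from pending_running[OF x this] show ?thesis
          using that(2) by (metis order_trans)
      qed
    qed
    then have "arrival (\<sigma> ! j) \<in> A" using j unfolding A_def pending_def by auto
    then show False using that(1) Min_le[OF finA] unfolding b_def by force
  qed
  \<comment> \<open>Selection by class rather than slack may include requests of slack above that of
    \<open>i\<close>; this only enlarges the bound and fits the classwise balance.\<close>
  define J where "J = {j. j < length \<sigma> \<and> b \<le> arrival (\<sigma> ! j) \<and> arrival (\<sigma> ! j) \<le> T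
              \<and> class_of (\<sigma> ! j) \<le> k \<and> asg j = x}"
  have finJ: "finite J" unfolding J_def by simp
  have cover: "{b..<T} \<subseteq> (\<Union>j\<in>J. {u. u < T \<and> S x u = Some j})"
  proof
    fix u assume u: "u \<in> {b..<T}"
    then obtain j where j: "S x u = Some j" "slack (\<sigma> ! j) \<le> slack (\<sigma> ! i)"
      using busy unfolding busy_def by auto
    have jp: "j \<in> pending s m \<sigma> asg S x u" using running_pending[OF x j(1)] .
    then have jl: "j < length \<sigma>" unfolding pending_def by simp
    have "b \<le> arrival (\<sigma> ! j)"
      using finished[OF _ j(2)] pending_antimono[OF jp, of b] u by force
    then have "j \<in> J"
      using jp j u class_of_mono[OF request_sequenceD(3)[OF requests jl] j(2)]
      unfolding J_def k_def pending_def by auto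
    then show "u \<in> (\<Union>j\<in>J. {u. u < T \<and> S x u = Some j})" using j u by auto
  qed
  have "T - b = measure lebesgue {b..<T}" using ba aT by simp
  also have "\<dots> \<le> measure lebesgue (\<Union>j\<in>J. {u. u < T \<and> S x u = Some j})"
    using cover finJ feasible_lmeasurable(1)[OF feasible x]
    by (intro measure_mono_fmeasurable fmeasurable.finite_UN) auto
  also have "\<dots> \<le> (\<Sum>j\<in>J. measure lebesgue {u. u < T \<and> S x u = Some j})"
    using finJ feasible_lmeasurable(1)[OF feasible x]
    by (intro measure_UNION_le) (auto intro: fmeasurableD)
  finally have "s * (T - b) \<le> (\<Sum>j\<in>J. s * measure lebesgue {u. u < T \<and> S x u = Some j})"
    using speed by (simp add: sum_distrib_left[symmetric])
  also have "\<dots> \<le> (\<Sum>j\<in>J. processing (\<sigma> ! j))"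
  proof (rule sum_mono)
    fix j assume "j \<in> J"
    then show "s * measure lebesgue {u. u < T \<and> S x u = Some j} \<le> processing (\<sigma> ! j)"
      using work_le_processing[of j T] work_eq[of j T] unfolding J_def by auto
  qed
  finally show ?thesis using that ba unfolding J_def by blast
qed

end

section \<open>Comparison with an offline schedule\<close>

text \<open>Arrivals are sorted, so both \<open>arrival < b\<close> and
  \<open>arrival \<le> T\<close> select initial segments. This translates the busy period into the
  index window of \<open>arrived_volume\<close>, ties included.\<close>

lemma sorted_arrivals_interval:
  assumes "request_sequence \<sigma>" "b \<le> T"
  obtains lo hi where "lo \<le> hi" "hi \<le> length \<sigma>"
    "\<And>j. (j < length \<sigma> \<and> b \<le> arrival (\<sigma> ! j) \<and> arrival (\<sigma> ! j) \<le> T) \<longleftrightarrow> lo \<le> j \<and> j < hi"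
proof -
  have prefix: "\<exists>n\<le>length \<sigma>. \<forall>j. (j < length \<sigma> \<and> P (arrival (\<sigma> ! j))) \<longleftrightarrow> j < n"
    if P: "\<And>u v. u \<le> v \<Longrightarrow> P v \<Longrightarrow> P u" for P :: "real \<Rightarrow> bool"
  proof (cases "\<exists>j<length \<sigma>. \<not> P (arrival (\<sigma> ! j))")
    case False
    then show ?thesis by (intro exI[of _ "length \<sigma>"]) auto
  next
    case True
    define n where "n = (LEAST j. j < length \<sigma> \<and> \<not> P (arrival (\<sigma> ! j)))"
    have n: "n < length \<sigma>" "\<not> P (arrival (\<sigma> ! n))"
      using LeastI_ex[OF True] unfolding n_def by auto
    have "P (arrival (\<sigma> ! j))" if "j < n" for j
      using not_less_Least[of j "\<lambda>j. j < length \<sigma> \<and> \<not> P (arrival (\<sigma> ! j))"] that n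
      unfolding n_def by auto
    moreover have "\<not> P (arrival (\<sigma> ! j))" if "n \<le> j" "j < length \<sigma>" for j
      using P[of "arrival (\<sigma> ! n)" "arrival (\<sigma> ! j)"] n that assms(1)
        sorted_nth_mono[of "map arrival \<sigma>" n j]
      unfolding request_sequence_def by auto
    ultimately show ?thesis using n by (intro exI[of _ n]) (metis less_imp_le less_trans not_le)
  qed
  obtain lo where lo: "lo \<le> length \<sigma>" "\<And>j. (j < length \<sigma> \<and> arrival (\<sigma> ! j) < b) \<longleftrightarrow> j < lo"
    using prefix[of "\<lambda>v. v < b"] le_less_trans by metis
  obtain hi where hi: "hi \<le> length \<sigma>" "\<And>j. (j < length \<sigma> \<and> arrival (\<sigma> ! j) \<le> T) \<longleftrightarrow> j < hi"
    using prefix[of "\<lambda>v. v \<le> T"] order_trans by metis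
  have "lo \<le> hi"
  proof (rule ccontr)
    assume "\<not> lo \<le> hi"
    then have "hi < lo" by simp
    then show False using lo(2)[of hi] hi(2)[of hi] assms(2) by auto
  qed
  then show ?thesis using that[of lo hi] hi lo(2) by (metis linorder_not_le)
qed

text \<open>The faster machine processes \<open>(1 + \<epsilon>) * (T - b)\<close> in the busy
  period, while the average volume per machine is what speed 1 can do slightly beyond
  \<open>T\<close>; the surplus \<open>\<epsilon> * (T - b)\<close> is thus bounded.\<close>

lemma SSF_I_unfinished_bound:
  assumes "request_sequence \<sigma>" "SSF_I (1 + \<epsilon>) m \<sigma> S" "0 < \<epsilon>"
    and opt: "feasible m \<sigma> S'" "delay_factor 1 m \<sigma> S' \<le> ereal \<alpha>" "1 \<le> \<alpha>"
    and i: "i < length \<sigma>" "arrival (\<sigma> ! i) \<le> T" "work (1 + \<epsilon>) m S i T < processing (\<sigma> ! i)"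
  shows "\<epsilon> * (T - arrival (\<sigma> ! i)) \<le> 10 * \<alpha> * slack (\<sigma> ! i)"
proof -
  obtain asg where "feasible m \<sigma> S" and dispatch: "immediate_dispatch m \<sigma> asg"
    and "shortest_slack_first (1 + \<epsilon>) m \<sigma> asg S"
    using assms(2) unfolding SSF_I_def by auto
  then interpret ssf_run "1 + \<epsilon>" m \<sigma> asg S
    using assms by unfold_locales auto
  define k where "k = class_of (\<sigma> ! i)"
  define x where "x = asg i"
  have "i \<in> pending (1 + \<epsilon>) m \<sigma> asg S x T"
    using i unfolding pending_def x_def by simp
  from busy_period[OF this] obtain b where b: "b \<le> arrival (\<sigma> ! i)"
    "(1 + \<epsilon>) * (T - b) \<le>
       (\<Sum>j | j < length \<sigma> \<and> b \<le> arrival (\<sigma> ! j) \<and> arrival (\<sigma> ! j) \<le> T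
              \<and> class_of (\<sigma> ! j) \<le> k \<and> asg j = x. processing (\<sigma> ! j))"
    unfolding k_def by blast
  have bT: "b \<le> T" using b(1) i(2) by simp
  obtain lo hi where h: "lo \<le> hi" "hi \<le> length \<sigma>"
    "\<And>j. (j < length \<sigma> \<and> b \<le> arrival (\<sigma> ! j) \<and> arrival (\<sigma> ! j) \<le> T) \<longleftrightarrow> lo \<le> j \<and> j < hi"
    using sorted_arrivals_interval[OF assms(1) bT] by blast
  have "{j. j < length \<sigma> \<and> b \<le> arrival (\<sigma> ! j) \<and> arrival (\<sigma> ! j) \<le> T
              \<and> class_of (\<sigma> ! j) \<le> k \<and> asg j = x} =
      {j. lo \<le> j \<and> j < hi \<and> class_of (\<sigma> ! j) \<le> k \<and> asg j = x}"
    using h(3) by blast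
  then have alg: "(1 + \<epsilon>) * (T - b) \<le> arrived_volume \<sigma> asg x k lo hi"
    using b(2) unfolding arrived_volume_def by simp
  \<comment> \<open>By \<open>?D\<close> the schedule \<open>S'\<close> has finished every request
    of class at most \<open>k\<close> that arrived by \<open>T\<close>, since such a slack is below
    \<open>2 powi (k + 1)\<close>.\<close>
  let ?D = "T + \<alpha> * 2 powi (k + 1)"
  have "(\<Sum>j | lo \<le> j \<and> j < hi \<and> class_of (\<sigma> ! j) \<le> k. processing (\<sigma> ! j)) \<le> real m * (?D - b)"
  proof (rule sum_processing_le[OF opt(1)])
    have "0 \<le> \<alpha> * 2 powi (k + 1)" using opt(3) by simp
    then show "b \<le> ?D" using bT by linarith
  next
    fix j assume "j \<in> {j. lo \<le> j \<and> j < hi \<and> class_of (\<sigma> ! j) \<le> k}"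
    then have j: "j < length \<sigma>" "b \<le> arrival (\<sigma> ! j)" "arrival (\<sigma> ! j) \<le> T"
        "class_of (\<sigma> ! j) \<le> k"
      using h(3)[of j] by auto
    show "b \<le> arrival (\<sigma> ! j)" by fact
    note sl = request_sequenceD(3)[OF assms(1) j(1)]
    have "slack (\<sigma> ! j) < 2 powi (class_of (\<sigma> ! j) + 1)" by (rule class_of_bounds[OF sl])
    also have "\<dots> \<le> 2 powi (k + 1)" using j(4) by (intro power_int_increasing) auto
    finally have "\<alpha> * slack (\<sigma> ! j) < \<alpha> * 2 powi (k + 1)" using opt(3) by simp
    then show "processing (\<sigma> ! j) \<le> work 1 m S' j ?D"
      using j(3) by (intro work_ge_processing_if_delay_le[OF opt(2,1) _ j(1) sl]) auto
  qed simp
  with arrived_volume_le_average[OF assms(1) dispatch h(1,2) asg_less[OF i(1)], of k]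
  have "real m * arrived_volume \<sigma> asg x k lo hi \<le> real m * (?D - b + 2 powi (k + 3))"
    unfolding x_def by (simp add: algebra_simps)
  then have "arrived_volume \<sigma> asg x k lo hi \<le> ?D - b + 2 powi (k + 3)"
    using asg_less[OF i(1)] by simp
  with alg have "\<epsilon> * (T - b) \<le> \<alpha> * 2 powi (k + 1) + 2 powi (k + 3)"
    by (simp add: algebra_simps)
  \<comment> \<open>Here \<open>8 \<le> 8 * \<alpha>\<close> absorbs the additive imbalance, giving
    the constant 10.\<close>
  also have "\<dots> = (2 * \<alpha> + 8) * 2 powi k" by (simp add: power_int_add algebra_simps)
  also have "\<dots> \<le> 10 * \<alpha> * slack (\<sigma> ! i)"
    using opt(3) class_of_bounds(1)[OF request_sequenceD(3)[OF assms(1) i(1)]]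
    unfolding k_def by (intro mult_mono) auto
  finally have "\<epsilon> * (T - b) \<le> 10 * \<alpha> * slack (\<sigma> ! i)" .
  moreover have "\<epsilon> * (T - arrival (\<sigma> ! i)) \<le> \<epsilon> * (T - b)"
    using b(1) assms(3) by (intro mult_left_mono) auto
  ultimately show ?thesis by linarith
qed

lemma SSF_I_delay_factor_le:
  assumes "request_sequence \<sigma>" "SSF_I (1 + \<epsilon>) m \<sigma> S" "0 < \<epsilon>" "\<epsilon> \<le> 1"
    and opt: "feasible m \<sigma> S'" "delay_factor 1 m \<sigma> S' \<le> ereal \<alpha>" "1 \<le> \<alpha>"
  shows "delay_factor (1 + \<epsilon>) m \<sigma> S \<le> ereal (11 * \<alpha> / \<epsilon>)"
proof -
  have "(completion (1 + \<epsilon>) m \<sigma> S i - ereal (arrival (\<sigma> ! i))) / ereal (slack (\<sigma> ! i))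
      \<le> ereal (11 * \<alpha> / \<epsilon>)" if i: "i < length \<sigma>" for i
  proof -
    let ?a = "arrival (\<sigma> ! i)" and ?s = "slack (\<sigma> ! i)"
    note s = request_sequenceD(3)[OF assms(1) i]
    \<comment> \<open>With 11 in place of 10, being unfinished at \<open>T\<close> would contradict
      \<open>SSF_I_unfinished_bound\<close>.\<close>
    define T where "T = ?a + 11 * \<alpha> * ?s / \<epsilon>"
    have "0 < \<alpha> * ?s" using s opt(3) by simp
    then have aT: "?a \<le> T" and "10 * \<alpha> * ?s < \<epsilon> * (T - ?a)"
      unfolding T_def using assms(3) by auto
    with SSF_I_unfinished_bound[OF assms(1-3) opt i aT]
    have "processing (\<sigma> ! i) \<le> work (1 + \<epsilon>) m S i T" by linarith
    then have "completion (1 + \<epsilon>) m \<sigma> S i \<le> ereal T"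
      unfolding completion_def using aT by (intro Inf_lower) auto
    then have "completion (1 + \<epsilon>) m \<sigma> S i - ereal ?a \<le> ereal (T - ?a)"
      by (cases "completion (1 + \<epsilon>) m \<sigma> S i") auto
    then have "(completion (1 + \<epsilon>) m \<sigma> S i - ereal ?a) / ereal ?s \<le> ereal (T - ?a) / ereal ?s"
      using s by (intro ereal_divide_right_mono) auto
    also have "\<dots> = ereal (11 * \<alpha> / \<epsilon>)" using s unfolding T_def by simp
    finally show ?thesis .
  qed
  \<comment> \<open>This covers the constant 1 in the maximum defining \<open>delay_factor\<close>;
    it rests on \<open>\<epsilon> \<le> 1\<close>.\<close>
  moreover have "1 \<le> 11 * \<alpha> / \<epsilon>" using assms(3,4) opt(3) by simp
  ultimately show ?thesis
    unfolding delay_factor_def by (subst Max_le_iff) (auto simp: one_ereal_def)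
qed

lemma one_le_opt: "1 \<le> opt m \<sigma>"
  unfolding opt_def delay_factor_def by (intro INF_greatest Max_ge) auto

theorem theorem2p5:
  "\<exists>C>0. \<forall>\<epsilon>::real. 0 < \<epsilon> \<and> \<epsilon> \<le> 1 \<longrightarrow>
     (\<forall>m\<ge>1. competitive SSF_I m (1 + \<epsilon>) (C / \<epsilon>))"
\<comment> \<open>The constant is twice the 11 of \<open>SSF_I_delay_factor_le\<close>.\<close>
proof (intro exI[of _ 22] conjI allI impI)
  fix \<epsilon> :: real and m :: nat
  assume \<epsilon>: "0 < \<epsilon> \<and> \<epsilon> \<le> 1"
  show "competitive SSF_I m (1 + \<epsilon>) (22 / \<epsilon>)"
    unfolding competitive_def
  proof (intro allI impI, elim conjE)
    fix \<sigma> S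
    assume *: "request_sequence \<sigma>" "SSF_I (1 + \<epsilon>) m \<sigma> S"
    show "delay_factor (1 + \<epsilon>) m \<sigma> S \<le> ereal (22 / \<epsilon>) * opt m \<sigma>"
    proof (cases "opt m \<sigma>")
      case (real v)
      have v: "1 \<le> v" using one_le_opt[of m \<sigma>] real by (simp add: one_ereal_def)
      \<comment> \<open>The infimum in \<open>opt\<close> need not be attained; the factor 2 pays for a near-optimal schedule.\<close>
      then have "opt m \<sigma> < ereal (2 * v)" using real by simp
      then obtain S' where "feasible m \<sigma> S'" "delay_factor 1 m \<sigma> S' < ereal (2 * v)"
        unfolding opt_def INF_less_iff by auto
      then have "delay_factor (1 + \<epsilon>) m \<sigma> S \<le> ereal (11 * (2 * v) / \<epsilon>)"
        using \<epsilon> v by (intro SSF_I_delay_factor_le[OF *]) auto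
      then show ?thesis using real by simp
    next
      case PInf
      then show ?thesis using \<epsilon> by simp
    next
      case MInf
      then show ?thesis using one_le_opt[of m \<sigma>] by simp
    qed
  qed
qed simp

end
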